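(* Let $X$ be a metric space, let $\mathcal{A}=\{A_1,\dots,A_n\}\subset H(X)$ be a nonempty finite set, suppose that $\Sigma(\mathcal{A})\ne\emptyset$, and let $d\in\Omega(\mathcal{A})$. Then each compact set from the class $\Sigma_d(\mathcal{A})$ contains at least one minimal Steiner compact from $\Sigma_d(\mathcal{A})$.
   Context: For a metric space $X$, $H(X)$ denotes the set of all nonempty compact subsets of $X$ endowed with the Hausdorff distance $d_H$. For $\mathcal{A}=\{A_1,\dots,A_n\}\subset H(X)$ and $K\in H(X)$ put $S_{\mathcal{A}}(K)=\sum_{i=1}^n d_H(K,A_i)$. $\Sigma(\mathcal{A})$ is the set of all $K\in H(X)$ at which $S_{\mathcal{A}}$ attains its minimum over $H(X)$; its elements are called Steiner compacts. $\Omega(\mathcal{A})=\{(d_H(K,A_1),\dots,d_H(K,A_n)):K\in\Sigma(\mathcal{A})\}$, and for $d=(d_1,\dots,d_n)\in\Omega(\mathcal{A})$, $\Sigma_d(\mathcal{A})=\{K\in\Sigma(\mathcal{A}): d_H(K,A_i)=d_i \text{ for all } i\}$. A minimal Steiner compact in $\Sigma_d(\mathcal{A})$ is a minimal element of $\Sigma_d(\mathcal{A})$ with respect to inclusion. *)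

theory Defs
  imports "HOL-Analysis.Analysis"
begin

text \<open>
  The ambient metric space \<open>X\<close> is the type \<^typ>\<open>'a :: metric_space\<close>. The points of the hyperspace
  \<open>H(X)\<close> are the nonempty compact sets.
\<close>

definition hyperspace :: "'a::metric_space set set" where
  "hyperspace = {K. compact K \<and> K \<noteq> {}}"

text \<open>
  The suprema are suprema of bounded nonempty sets of reals, and \<^const>\<open>infdist\<close> is a true infimum,
  whenever both arguments are nonempty and bounded; in particular on \<^const>\<open>hyperspace\<close>, the only
  place where the function is used.
\<close>

definition hausdorff_dist :: "'a::metric_space set \<Rightarrow> 'a set \<Rightarrow> real" where
  "hausdorff_dist A B = max (SUP a\<in>A. infdist a B) (SUP b\<in>B. infdist b A)"

text \<open>
  The boundary set \<open>{A\<^sub>1, \<dots>, A\<^sub>n}\<close> is given by its enumeration \<open>[A\<^sub>1, \<dots>, A\<^sub>n]\<close>, so that tuples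
  \<open>(d\<^sub>1, \<dots>, d\<^sub>n)\<close> are lists of the same length. The enumeration may have repetitions.
\<close>

definition dist_vector :: "'a::metric_space set list \<Rightarrow> 'a set \<Rightarrow> real list" where
  "dist_vector As K = map (\<lambda>A. hausdorff_dist K A) As"

definition dist_sum :: "'a::metric_space set list \<Rightarrow> 'a set \<Rightarrow> real" where
  "dist_sum As K = (\<Sum>i<length As. hausdorff_dist K (As ! i))"

definition Steiner_compacts :: "'a::metric_space set list \<Rightarrow> 'a set set" where
  "Steiner_compacts As =
     {K \<in> hyperspace. \<forall>L \<in> hyperspace. dist_sum As K \<le> dist_sum As L}"

definition Steiner_vectors :: "'a::metric_space set list \<Rightarrow> real list set" where
  "Steiner_vectors As = dist_vector As ` Steiner_compacts As"

definition Steiner_class :: "'a::metric_space set list \<Rightarrow> real list \<Rightarrow> 'a set set" where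
  "Steiner_class As d = {K \<in> Steiner_compacts As. dist_vector As K = d}"

definition minimal_Steiner_compact ::
    "'a::metric_space set list \<Rightarrow> real list \<Rightarrow> 'a set \<Rightarrow> bool" where
  "minimal_Steiner_compact As d M \<longleftrightarrow>
     M \<in> Steiner_class As d \<and> (\<forall>L \<in> Steiner_class As d. L \<subseteq> M \<longrightarrow> L = M)"

end

theory Submission
  imports Defs
begin

text \<open>
  By Zorn's lemma it suffices that \<open>Steiner_class As d\<close> is closed under intersections of nonempty
  chains. Let \<open>M\<close> be such an intersection; it is compact and nonempty. Passing to \<open>M\<close> cannot
  increase the Hausdorff distance to a fixed compact set \<open>A\<close> beyond a bound \<open>r\<close> shared by the
  members of the chain: a point of \<open>M\<close> lies in the members, so it is within \<open>r\<close> of \<open>A\<close>; and for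
  \<open>a \<in> A\<close> the sets \<open>L \<inter> cball a r\<close>, with \<open>L\<close> in the chain, are again a chain of nonempty compact
  sets, so they have a common point, which is a point of \<open>M\<close> within \<open>r\<close> of \<open>a\<close>.

  Thus every distance from \<open>M\<close> to a boundary set is at most the corresponding entry of \<open>d\<close>. The
  entries of \<open>d\<close> add up to the minimum of \<open>dist_sum As\<close>, so none of these inequalities can be
  strict, and \<open>M\<close> again has distance vector \<open>d\<close>.
\<close>

section \<open>Chains of compact sets\<close>

text \<open>
  A finite subfamily of a chain has a least member, so the finite intersection property holds; the
  Hausdorff separation axiom is what makes the members closed.
\<close>

lemma compact_Inter_chain_nonempty:
  fixes C :: "'a::t2_space set set"
  assumes "C \<noteq> {}" and chain: "subset.chain UNIV C"
    and comp: "\<And>L. L \<in> C \<Longrightarrow> compact L" and ne: "\<And>L. L \<in> C \<Longrightarrow> L \<noteq> {}"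
  shows "\<Inter>C \<noteq> {}"
proof -
  obtain K where K: "K \<in> C"
    using \<open>C \<noteq> {}\<close> by blast
  have "K \<inter> \<Inter>C \<noteq> {}"
  proof (rule compact_imp_fip)
    show "compact K" by (rule comp[OF K])
    show "closed L" if "L \<in> C" for L
      using comp[OF that] by (rule compact_imp_closed)
    fix F assume F: "finite F" "F \<subseteq> C"
    have "subset.chain UNIV (insert K F)"
      using chain F(2) K by (auto simp: subset_chain_def)
    then have "\<Inter>(insert K F) \<in> insert K F"
      using F(1) by (intro Inter_in_chain) auto
    then have "\<Inter>(insert K F) \<in> C"
      using F(2) K by (intro subsetD[of "insert K F" C]) simp_all
    then have "\<Inter>(insert K F) \<noteq> {}"
      by (rule ne)
    then show "K \<inter> \<Inter>F \<noteq> {}" by simp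
  qed
  then show ?thesis by blast
qed

text \<open>
  Compactness makes the infimum attained. A bound on the distance thereby becomes the nonemptiness
  of a compact set, to which the intersection property of chains applies.
\<close>

lemma infdist_le_compact_iff:
  assumes "compact K" "K \<noteq> {}"
  shows "infdist a K \<le> r \<longleftrightarrow> K \<inter> cball a r \<noteq> {}"
proof
  assume le: "infdist a K \<le> r"
  obtain x where x: "x \<in> K" "\<forall>y\<in>K. dist a x \<le> dist a y"
    using continuous_attains_inf[OF assms continuous_on_dist[OF continuous_on_const continuous_on_id]]
    by blast
  have "dist a x \<le> infdist a K"
    using x assms(2) by (auto simp: infdist_def intro: cINF_greatest)
  then show "K \<inter> cball a r \<noteq> {}"
    using le x(1) by force
qed (auto intro: infdist_le2)

lemma infdist_Inter_chain_le:
  assumes C: "C \<noteq> {}" "subset.chain UNIV C" "C \<subseteq> hyperspace"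
    and le: "\<And>L. L \<in> C \<Longrightarrow> infdist a L \<le> r"
  shows "infdist a (\<Inter>C) \<le> r"
proof -
  have "\<Inter>((\<lambda>L. L \<inter> cball a r) ` C) \<noteq> {}"
  proof (rule compact_Inter_chain_nonempty)
    show "subset.chain UNIV ((\<lambda>L. L \<inter> cball a r) ` C)"
      using C(2) unfolding subset_chain_def by blast
  next
    fix T assume "T \<in> (\<lambda>L. L \<inter> cball a r) ` C"
    then obtain L where L: "L \<in> C" "T = L \<inter> cball a r" by blast
    then have "compact L" "L \<noteq> {}"
      using C(3) by (auto simp: hyperspace_def)
    then show "compact T" "T \<noteq> {}"
      using le[OF L(1)] L(2) infdist_le_compact_iff[of L a r] compact_Int_closed[of L "cball a r"]
      by simp_all
  qed (use C(1) in blast)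
  then obtain x where "\<forall>L\<in>C. x \<in> L \<inter> cball a r" by blast
  then show ?thesis
    using C(1) by (intro infdist_le2[of x]) auto
qed

lemma Inter_chain_in_hyperspace:
  assumes "C \<noteq> {}" "subset.chain UNIV C" "C \<subseteq> hyperspace"
  shows "\<Inter>C \<in> hyperspace"
proof -
  have C: "compact L" "L \<noteq> {}" if "L \<in> C" for L
    using subsetD[OF assms(3) that] by (simp_all add: hyperspace_def)
  obtain K where K: "K \<in> C"
    using assms(1) by blast
  have "closed (\<Inter>C)"
    using C(1) by (intro closed_Inter ballI compact_imp_closed)
  then have "compact (K \<inter> \<Inter>C)"
    using C(1)[OF K] by (rule compact_Int_closed[rotated])
  then have "compact (\<Inter>C)"
    using K by (simp add: Int_absorb1 Inter_lower)
  then show ?thesis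
    using compact_Inter_chain_nonempty[OF assms(1,2) C] by (simp add: hyperspace_def)
qed

section \<open>Hausdorff distance along a chain\<close>

lemma hausdorff_dist_le_iff:
  assumes "A \<in> hyperspace" "B \<in> hyperspace"
  shows "hausdorff_dist A B \<le> r \<longleftrightarrow> (\<forall>a\<in>A. infdist a B \<le> r) \<and> (\<forall>b\<in>B. infdist b A \<le> r)"
proof -
  have bdd: "bdd_above ((\<lambda>x. infdist x T) ` S)" if "S \<in> hyperspace" for S T :: "'a set"
    using that
    by (intro bounded_imp_bdd_above compact_imp_bounded compact_continuous_image)
      (auto simp: hyperspace_def intro!: continuous_intros)
  show ?thesis
    using assms bdd[OF assms(1)] bdd[OF assms(2)]
    by (simp add: hausdorff_dist_def cSUP_le_iff hyperspace_def)
qed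

lemma hausdorff_dist_Inter_chain_le:
  assumes C: "C \<noteq> {}" "subset.chain UNIV C" "C \<subseteq> hyperspace" and A: "A \<in> hyperspace"
    and le: "\<And>L. L \<in> C \<Longrightarrow> hausdorff_dist L A \<le> r"
  shows "hausdorff_dist (\<Inter>C) A \<le> r"
proof -
  have L: "(\<forall>x\<in>L. infdist x A \<le> r) \<and> (\<forall>a\<in>A. infdist a L \<le> r)" if "L \<in> C" for L
    using le[OF that] hausdorff_dist_le_iff[of L A] A C(3) that by blast
  have "infdist a (\<Inter>C) \<le> r" if "a \<in> A" for a
    using L that by (intro infdist_Inter_chain_le[OF C]) blast
  moreover have "infdist x A \<le> r" if "x \<in> \<Inter>C" for x
    using L that C(1) by blast
  ultimately show ?thesis
    using hausdorff_dist_le_iff[OF Inter_chain_in_hyperspace[OF C] A] by blast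
qed

section \<open>Minimal Steiner compacts\<close>

text \<open>
  The class \<open>Steiner_class As d\<close> can be entered with inequalities only: minimality of the sum forces
  them to be equalities.
\<close>

lemma Steiner_class_if_le:
  assumes K: "K \<in> Steiner_class As d" and M: "M \<in> hyperspace"
    and le: "\<And>A. A \<in> set As \<Longrightarrow> hausdorff_dist M A \<le> hausdorff_dist K A"
  shows "M \<in> Steiner_class As d"
proof -
  have K': "K \<in> Steiner_compacts As" "dist_vector As K = d"
    using K by (auto simp: Steiner_class_def)
  have MK: "dist_sum As M \<le> dist_sum As K"
    unfolding dist_sum_def by (intro sum_mono le) auto
  have min: "dist_sum As K \<le> dist_sum As L" if "L \<in> hyperspace" for L
    using K'(1) that by (simp add: Steiner_compacts_def)
  have sum_eq: "dist_sum As M = dist_sum As K"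
    using MK min[OF M] by (rule antisym)
  then have "M \<in> Steiner_compacts As"
    using M min by (simp add: Steiner_compacts_def)
  moreover have "hausdorff_dist M (As ! i) = hausdorff_dist K (As ! i)" if "i < length As" for i
    by (rule sum_mono_inv[OF sum_eq[unfolded dist_sum_def]]) (auto intro: le that)
  then have "dist_vector As M = d"
    using K'(2) by (auto simp: dist_vector_def intro: nth_equalityI)
  ultimately show ?thesis by (simp add: Steiner_class_def)
qed

lemma Inter_chain_in_Steiner_class:
  assumes As: "set As \<subseteq> hyperspace"
    and C: "C \<noteq> {}" "subset.chain UNIV C" "C \<subseteq> Steiner_class As d"
  shows "\<Inter>C \<in> Steiner_class As d"
proof -
  obtain K where K: "K \<in> C"
    using C(1) by blast
  have hyp: "C \<subseteq> hyperspace"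
    using C(3) by (auto simp: Steiner_class_def Steiner_compacts_def)
  have same: "hausdorff_dist L A = hausdorff_dist K A" if "L \<in> C" "A \<in> set As" for L A
  proof -
    have "dist_vector As L = dist_vector As K"
      using C(3) K that(1) by (auto simp: Steiner_class_def)
    then show ?thesis
      using that(2) by (simp add: dist_vector_def)
  qed
  show ?thesis
  proof (rule Steiner_class_if_le)
    show "K \<in> Steiner_class As d" using K C(3) by blast
    show "\<Inter>C \<in> hyperspace" by (rule Inter_chain_in_hyperspace[OF C(1,2) hyp])
    show "hausdorff_dist (\<Inter>C) A \<le> hausdorff_dist K A" if "A \<in> set As" for A
      using As that same by (intro hausdorff_dist_Inter_chain_le[OF C(1,2) hyp]) auto
  qed
qed

theorem mainTheorem3:
  fixes As :: "'a::metric_space set list" and d :: "real list"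
  assumes "As \<noteq> []"
    and "set As \<subseteq> hyperspace"
    and "Steiner_compacts As \<noteq> {}"
    and "d \<in> Steiner_vectors As"
  shows "\<forall>K \<in> Steiner_class As d. \<exists>M. minimal_Steiner_compact As d M \<and> M \<subseteq> K"
proof
  fix K assume K: "K \<in> Steiner_class As d"
  define S where "S = {L \<in> Steiner_class As d. L \<subseteq> K}"
  have "\<exists>M\<in>S. \<forall>L\<in>S. M \<supseteq> L \<longrightarrow> L = M"
  proof (rule predicate_Zorn)
    show "partial_order_on S (relation_of (\<lambda>A B. A \<supseteq> B) S)"
      by (rule partial_order_on_relation_ofI) auto
  next
    fix C assume "C \<in> Chains (relation_of (\<lambda>A B. A \<supseteq> B) S)"
    then have sub: "C \<subseteq> S" and chain: "subset.chain UNIV C"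
      by (auto simp: Chains_def relation_of_def subset_chain_def)
    show "\<exists>M\<in>S. \<forall>L\<in>C. L \<supseteq> M"
    proof (cases "C = {}")
      case True
      then show ?thesis using K by (auto simp: S_def)
    next
      case False
      then have "\<Inter>C \<in> Steiner_class As d"
        using sub chain by (intro Inter_chain_in_Steiner_class assms) (auto simp: S_def)
      then have "\<Inter>C \<in> S"
        using False sub by (auto simp: S_def)
      then show ?thesis by blast
    qed
  qed
  then obtain M where M: "M \<in> S" "\<forall>L\<in>S. L \<subseteq> M \<longrightarrow> L = M"
    by blast
  have "L = M" if "L \<in> Steiner_class As d" "L \<subseteq> M" for L
    using that M unfolding S_def by blast
  then show "\<exists>M. minimal_Steiner_compact As d M \<and> M \<subseteq> K"
    using M(1) unfolding S_def minimal_Steiner_compact_def by blast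
qed

end
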